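(* Let $C:L^2(\mathbb{T})\to L^2(\mathbb{T})$ be a conjugation such that $CM_{z^2}=M_{\bar z^2}C$. Then there exist $\phi_1,\phi_2\in L^\infty(\mathbb{T})$ such that $C=M_{[\phi_1,\phi_2]}\mathscr{C}_{z^2}$, where $\phi_1,\phi_2$ satisfy $|\phi_1|^2+|\phi_2|^2=2$ a.e. on $\mathbb{T}$ and $\phi_1^e=\phi_2^e$. Conversely, any conjugation $C$ on $L^2(\mathbb{T})$ of the form $C=M_{[\phi_1,\phi_2]}\mathscr{C}_{z^2}$ with $\phi_1,\phi_2\in L^\infty(\mathbb{T})$ satisfies $CM_{z^2}=M_{\bar z^2}C$.
   Context: $\mathbb{T}$ is the unit circle with normalized Lebesgue measure. A conjugation on a Hilbert space $\mathcal{H}$ is an antilinear map $C:\mathcal{H}\to\mathcal{H}$ with $C^2=I$ and $\langle Cf,Cg\rangle=\langle g,f\rangle$ for all $f,g$. For $\phi\in L^\infty(\mathbb{T})$, $M_\phi f=\phi f$ on $L^2(\mathbb{T})$. For $f\in L^2(\mathbb{T})$, $f^e(z)=\frac{f(z)+f(-z)}{2}$ and $f^o(z)=\frac{f(z)-f(-z)}{2}$ are the even and odd parts, so $f=f^e+f^o$. For $\phi_1,\phi_2\in L^\infty(\mathbb{T})$, $M_{[\phi_1,\phi_2]}$ is the bounded linear operator on $L^2(\mathbb{T})$ given by $M_{[\phi_1,\phi_2]}f=\phi_1f^e+\phi_2f^o$. The conjugation $\mathscr{C}_{z^2}$ on $L^2(\mathbb{T})$ is $\mathscr{C}_{z^2}f=z\overline{f}$.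 *)

theory Defs
  imports "HOL-Analysis.Analysis"
begin

section \<open>Complex inner product spaces and conjugations\<close>

class complex_inner = ab_group_add +
  fixes cscale :: "complex \<Rightarrow> 'a \<Rightarrow> 'a"  (infixr \<open>*\<^sub>c\<close> 75)
    and cinner :: "'a \<Rightarrow> 'a \<Rightarrow> complex"
  assumes cscale_add_right: "a *\<^sub>c (x + y) = a *\<^sub>c x + a *\<^sub>c y"
    and cscale_add_left: "(a + b) *\<^sub>c x = a *\<^sub>c x + b *\<^sub>c x"
    and cscale_cscale: "a *\<^sub>c (b *\<^sub>c x) = (a * b) *\<^sub>c x"
    and cscale_one: "1 *\<^sub>c x = x"
    and cinner_add_left: "cinner (x + y) z = cinner x z + cinner y z"
    and cinner_cscale_left: "cinner (a *\<^sub>c x) y = a * cinner x y"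
    and cinner_commute: "cinner x y = cnj (cinner y x)"
    and cinner_ge_zero: "0 \<le> Re (cinner x x)"
    and cinner_eq_zero_iff: "cinner x x = 0 \<longleftrightarrow> x = 0"

text \<open>Completeness of the space plays no role in the definition of a conjugation, so it is not part
  of the class.\<close>

definition conjugation :: "('a::complex_inner \<Rightarrow> 'a) \<Rightarrow> bool" where
  "conjugation C \<longleftrightarrow>
     (\<forall>f g. C (f + g) = C f + C g) \<and>
     (\<forall>a f. C (a *\<^sub>c f) = cnj a *\<^sub>c C f) \<and>
     C \<circ> C = id \<and>
     (\<forall>f g. cinner (C f) (C g) = cinner g f)"


section \<open>The unit circle with normalized Lebesgue measure\<close>

definition circle :: "complex measure" where
  "circle = distr (uniform_measure lborel {0..<2 * pi}) (restrict_space borel (sphere 0 1)) cis"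

lemma space_circle: "space circle = sphere 0 1"
  by (simp add: circle_def space_restrict_space)

lemma sets_circle: "sets circle = sets (restrict_space borel (sphere 0 1))"
  by (simp add: circle_def)

lemma norm_circle: "z \<in> space circle \<Longrightarrow> cmod z = 1"
  by (simp add: space_circle)

lemma borel_measurable_circle: "f \<in> borel_measurable borel \<Longrightarrow> f \<in> borel_measurable circle"
  using measurable_restrict_space1 measurable_cong_sets[OF sets_circle refl] by blast

lemma borel_measurable_cnj [measurable (raw)]:
  "f \<in> borel_measurable M \<Longrightarrow> (\<lambda>x. cnj (f x)) \<in> borel_measurable M"
  by (rule measurable_compose[where g=cnj])
    (auto intro!: borel_measurable_continuous_onI continuous_intros)

lemma cis_borel [measurable]: "cis \<in> borel_measurable borel"
  by (intro borel_measurable_continuous_onI continuous_intros)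

lemma cis_circle: "cis \<in> measurable borel circle"
proof -
  have "cis \<in> measurable borel (restrict_space borel (sphere 0 1))"
    by (rule measurable_restrict_space2) auto
  then show ?thesis
    using measurable_cong_sets[OF refl sets_circle] by blast
qed

lemma uminus_circle: "uminus \<in> measurable circle circle"
proof -
  have "uminus \<in> measurable circle (restrict_space borel (sphere 0 1))"
    by (rule measurable_restrict_space2) (auto simp: space_circle intro: borel_measurable_circle)
  then show ?thesis
    using measurable_cong_sets[OF refl sets_circle] by blast
qed

lemma emeasure_circle:
  assumes "A \<in> sets circle"
  shows "emeasure circle A =
    (\<integral>\<^sup>+t. indicator A (cis t) * indicator {0..<2 * pi} t \<partial>lborel) / ennreal (2 * pi)"
proof -
  have A: "A \<in> sets (restrict_space borel (sphere 0 1))"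
    using assms sets_circle by simp
  have m: "cis \<in> measurable lborel (restrict_space borel (sphere 0 1))"
    by (rule measurable_restrict_space2) auto
  have vA: "cis -` A \<in> sets lborel"
    using measurable_sets[OF m A] by simp
  have "emeasure circle A = emeasure (uniform_measure lborel {0..<2 * pi}) (cis -` A)"
    unfolding circle_def using m A by (subst emeasure_distr) simp_all
  also have "\<dots> = emeasure lborel ({0..<2 * pi} \<inter> cis -` A) / ennreal (2 * pi)"
    using vA by (subst emeasure_uniform_measure) simp_all
  also have "emeasure lborel ({0..<2 * pi} \<inter> cis -` A) =
      (\<integral>\<^sup>+t. indicator A (cis t) * indicator {0..<2 * pi} t \<partial>lborel)"
  proof -
    have "emeasure lborel ({0..<2 * pi} \<inter> cis -` A) =
        (\<integral>\<^sup>+t. indicator ({0..<2 * pi} \<inter> cis -` A) t \<partial>lborel)"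
      using vA by (intro nn_integral_indicator [symmetric]) auto
    also have "\<dots> = (\<integral>\<^sup>+t. indicator A (cis t) * indicator {0..<2 * pi} t \<partial>lborel)"
      by (intro nn_integral_cong) (auto simp: indicator_def)
    finally show ?thesis .
  qed
  finally show ?thesis .
qed

lemma emeasure_circle_space: "emeasure circle (space circle) = 1"
proof -
  have "(\<integral>\<^sup>+t. indicator (space circle) (cis t) * indicator {0..<2 * pi} t \<partial>lborel) =
      (\<integral>\<^sup>+t. indicator {0..<2 * pi} t \<partial>lborel)"
    by (intro nn_integral_cong) (simp add: space_circle indicator_def)
  then show ?thesis
    by (subst emeasure_circle) (auto simp: ennreal_divide_self)
qed

interpretation circle: finite_measure circle
  by standard (simp add: emeasure_circle_space)

lemma nn_integral_periodic_shift:
  fixes h :: "real \<Rightarrow> ennreal"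
  assumes [measurable]: "h \<in> borel_measurable borel" and per: "\<And>t. h (t + 2 * pi) = h t"
  shows "(\<integral>\<^sup>+t. h (t + pi) * indicator {0..<2 * pi} t \<partial>lborel) =
    (\<integral>\<^sup>+t. h t * indicator {0..<2 * pi} t \<partial>lborel)"
proof -
  have "(\<integral>\<^sup>+t. h (t + pi) * indicator {0..<2 * pi} t \<partial>lborel) =
      (\<integral>\<^sup>+t. h (t + pi) * indicator {0..<pi} t + h (t + pi) * indicator {pi..<2 * pi} t \<partial>lborel)"
    by (intro nn_integral_cong) (auto simp: indicator_def)
  also have "\<dots> = (\<integral>\<^sup>+t. h (t + pi) * indicator {0..<pi} t \<partial>lborel) +
      (\<integral>\<^sup>+t. h (t + pi) * indicator {pi..<2 * pi} t \<partial>lborel)"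
    by (rule nn_integral_add) simp_all
  also have "(\<integral>\<^sup>+t. h (t + pi) * indicator {0..<pi} t \<partial>lborel) =
      (\<integral>\<^sup>+t. h t * indicator {pi..<2 * pi} t \<partial>lborel)"
    by (subst nn_integral_real_affine[where c=1 and t="- pi"])
      (auto intro!: nn_integral_cong simp: indicator_def)
  also have "(\<integral>\<^sup>+t. h (t + pi) * indicator {pi..<2 * pi} t \<partial>lborel) =
      (\<integral>\<^sup>+t. h t * indicator {0..<pi} t \<partial>lborel)"
  proof (subst nn_integral_real_affine[where c=1 and t="pi"])
    have "h (pi + x + pi) = h x" for x
      using per[of x] by (simp add: algebra_simps)
    then show "ennreal \<bar>1\<bar> * (\<integral>\<^sup>+x. h (pi + 1 * x + pi) * indicator {pi..<2 * pi} (pi + 1 * x) \<partial>lborel) =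
        (\<integral>\<^sup>+t. h t * indicator {0..<pi} t \<partial>lborel)"
      by (auto intro!: nn_integral_cong simp: indicator_def)
  qed simp_all
  also have "(\<integral>\<^sup>+t. h t * indicator {pi..<2 * pi} t \<partial>lborel) + (\<integral>\<^sup>+t. h t * indicator {0..<pi} t \<partial>lborel) =
      (\<integral>\<^sup>+t. h t * indicator {pi..<2 * pi} t + h t * indicator {0..<pi} t \<partial>lborel)"
    by (rule nn_integral_add [symmetric]) simp_all
  also have "\<dots> = (\<integral>\<^sup>+t. h t * indicator {0..<2 * pi} t \<partial>lborel)"
    by (intro nn_integral_cong) (auto simp: indicator_def)
  finally show ?thesis .
qed

lemma distr_circle_uminus: "distr circle circle uminus = circle"
proof (rule measure_eqI)
  fix A assume "A \<in> sets (distr circle circle uminus)"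
  then have A: "A \<in> sets circle" by simp
  then have A': "uminus -` A \<inter> space circle \<in> sets circle"
    by (rule measurable_sets[OF uminus_circle])
  have [measurable]: "(\<lambda>t. indicator A (cis t) :: ennreal) \<in> borel_measurable borel"
    using measurable_compose[OF cis_circle borel_measurable_indicator[OF A]] .
  have "emeasure (distr circle circle uminus) A = emeasure circle (uminus -` A \<inter> space circle)"
    using uminus_circle A by (rule emeasure_distr)
  also have "\<dots> = (\<integral>\<^sup>+t. indicator A (cis (t + pi)) * indicator {0..<2 * pi} t \<partial>lborel) / ennreal (2 * pi)"
    unfolding emeasure_circle[OF A']
    by (intro arg_cong2[where f="(/)"] nn_integral_cong refl)
      (simp add: indicator_def space_circle cis_mult [symmetric])
  also have "\<dots> = emeasure circle A"
    unfolding emeasure_circle[OF A]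
    by (subst nn_integral_periodic_shift) (simp_all add: cis_mult [symmetric])
  finally show "emeasure (distr circle circle uminus) A = emeasure circle A" .
qed simp

lemma AE_circle_uminus:
  assumes "AE z in circle. P z"
  shows "AE z in circle. P (- z)"
proof -
  have "AE z in distr circle circle uminus. P z"
    unfolding distr_circle_uminus by (rule assms)
  then show ?thesis
    by (rule AE_distrD[OF uminus_circle])
qed

lemma measurable_circle_uminus:
  "f \<in> borel_measurable circle \<Longrightarrow> (\<lambda>z. f (- z)) \<in> borel_measurable circle"
  by (rule measurable_compose[OF uminus_circle])


section \<open>The space $L^2$ of the circle\<close>

definition square_integrable :: "(complex \<Rightarrow> complex) \<Rightarrow> bool" where
  "square_integrable f \<longleftrightarrow>
     f \<in> borel_measurable circle \<and> integrable circle (\<lambda>z. (cmod (f z))\<^sup>2)"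

definition L2_rel :: "(complex \<Rightarrow> complex) \<Rightarrow> (complex \<Rightarrow> complex) \<Rightarrow> bool" where
  "L2_rel f g \<longleftrightarrow> square_integrable f \<and> square_integrable g \<and> (AE z in circle. f z = g z)"

lemma square_integrable_bound:
  assumes "f \<in> borel_measurable circle" "integrable circle h"
    and "\<And>z. z \<in> space circle \<Longrightarrow> (cmod (f z))\<^sup>2 \<le> h z"
  shows "square_integrable f"
  unfolding square_integrable_def using assms
  by (auto intro!: Bochner_Integration.integrable_bound[OF assms(2)] AE_I2 order_trans[OF _ abs_ge_self])

lemma square_integrable_0: "square_integrable (\<lambda>z. 0)"
  by (simp add: square_integrable_def)

lemma square_integrable_add:
  assumes "square_integrable f" "square_integrable g"
  shows "square_integrable (\<lambda>z. f z + g z)"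
proof (rule square_integrable_bound)
  show "integrable circle (\<lambda>z. 2 * ((cmod (f z))\<^sup>2 + (cmod (g z))\<^sup>2))"
    using assms by (simp add: square_integrable_def)
  fix z
  have "(cmod (f z + g z))\<^sup>2 \<le> (cmod (f z) + cmod (g z))\<^sup>2"
    by (intro power_mono norm_triangle_ineq) simp
  also have "\<dots> \<le> 2 * ((cmod (f z))\<^sup>2 + (cmod (g z))\<^sup>2)"
    using sum_squares_bound[of "cmod (f z)" "cmod (g z)"] by (simp add: power2_sum)
  finally show "(cmod (f z + g z))\<^sup>2 \<le> 2 * ((cmod (f z))\<^sup>2 + (cmod (g z))\<^sup>2)" .
qed (use assms in \<open>auto simp: square_integrable_def\<close>)

lemma square_integrable_cmult:
  "square_integrable f \<Longrightarrow> square_integrable (\<lambda>z. c * f z)"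
  by (auto simp: square_integrable_def norm_mult power_mult_distrib)

lemma square_integrable_uminus:
  "square_integrable f \<Longrightarrow> square_integrable (\<lambda>z. - f z)"
  by (simp add: square_integrable_def)

lemma square_integrable_diff:
  "square_integrable f \<Longrightarrow> square_integrable g \<Longrightarrow> square_integrable (\<lambda>z. f z - g z)"
  using square_integrable_add[of f "\<lambda>z. - g z"] square_integrable_uminus by simp

lemma square_integrable_reflect:
  assumes "square_integrable f"
  shows "square_integrable (\<lambda>z. f (- z))"
  using assms integrable_distr[OF uminus_circle, of "\<lambda>z. (cmod (f z))\<^sup>2"]
  by (simp add: square_integrable_def measurable_circle_uminus distr_circle_uminus)

lemma integrable_inner:
  assumes "square_integrable f" "square_integrable g"
  shows "integrable circle (\<lambda>z. f z * cnj (g z))"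
proof (rule Bochner_Integration.integrable_bound)
  show "integrable circle (\<lambda>z. (cmod (f z))\<^sup>2 + (cmod (g z))\<^sup>2)"
    using assms by (simp add: square_integrable_def)
  have "cmod (f z) * cmod (g z) \<le> (cmod (f z))\<^sup>2 + (cmod (g z))\<^sup>2" for z
    using sum_squares_bound[of "cmod (f z)" "cmod (g z)"]
      mult_nonneg_nonneg[OF norm_ge_zero norm_ge_zero, of "f z" "g z"] by linarith
  then show "AE z in circle. norm (f z * cnj (g z)) \<le> norm ((cmod (f z))\<^sup>2 + (cmod (g z))\<^sup>2)"
    by (simp add: norm_mult)
qed (use assms in \<open>auto simp: square_integrable_def\<close>)

quotient_type L2T = "complex \<Rightarrow> complex" / partial: L2_rel
proof (rule part_equivpI)
  show "\<exists>f. L2_rel f f"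
    using square_integrable_0 by (auto simp: L2_rel_def)
  show "symp L2_rel"
    by (auto simp: symp_def L2_rel_def)
  show "transp L2_rel"
    by (auto simp: transp_def L2_rel_def)
qed

instantiation L2T :: complex_inner
begin

lift_definition zero_L2T :: L2T is "\<lambda>z. 0"
  by (simp add: L2_rel_def square_integrable_0)

lift_definition plus_L2T :: "L2T \<Rightarrow> L2T \<Rightarrow> L2T" is "\<lambda>f g z. f z + g z"
  by (auto simp: L2_rel_def square_integrable_add)

lift_definition uminus_L2T :: "L2T \<Rightarrow> L2T" is "\<lambda>f z. - f z"
  by (auto simp: L2_rel_def square_integrable_uminus)

lift_definition minus_L2T :: "L2T \<Rightarrow> L2T \<Rightarrow> L2T" is "\<lambda>f g z. f z - g z"
  by (auto simp: L2_rel_def square_integrable_diff)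

lift_definition cscale_L2T :: "complex \<Rightarrow> L2T \<Rightarrow> L2T" is "\<lambda>c f z. c * f z"
  by (auto simp: L2_rel_def square_integrable_cmult)

lift_definition cinner_L2T :: "L2T \<Rightarrow> L2T \<Rightarrow> complex" is
  "\<lambda>f g. \<integral>z. f z * cnj (g z) \<partial>circle"
  by (rule integral_cong_AE) (auto simp: L2_rel_def square_integrable_def)

instance
proof
  fix a b :: complex and x y z :: L2T
  show "x + y + z = x + (y + z)"
    by transfer (simp add: L2_rel_def square_integrable_add add.assoc)
  show "x + y = y + x"
    by transfer (simp add: L2_rel_def square_integrable_add add.commute)
  show "0 + x = x"
    by transfer (simp add: L2_rel_def)
  show "- x + x = 0"
    by transfer (simp add: L2_rel_def square_integrable_0)
  show "x - y = x + - y"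
    by transfer (simp add: L2_rel_def square_integrable_diff)
  show "a *\<^sub>c (x + y) = a *\<^sub>c x + a *\<^sub>c y"
    by transfer (simp add: L2_rel_def square_integrable_add square_integrable_cmult distrib_left)
  show "(a + b) *\<^sub>c x = a *\<^sub>c x + b *\<^sub>c x"
    by transfer (simp add: L2_rel_def square_integrable_add square_integrable_cmult distrib_right)
  show "a *\<^sub>c (b *\<^sub>c x) = (a * b) *\<^sub>c x"
    by transfer (simp add: L2_rel_def square_integrable_cmult mult.assoc)
  show "1 *\<^sub>c x = x"
    by transfer (simp add: L2_rel_def)
  show "cinner (x + y) z = cinner x z + cinner y z"
    by transfer (simp add: L2_rel_def distrib_right integrable_inner)
  show "cinner (a *\<^sub>c x) y = a * cinner x y"
    by transfer (simp add: L2_rel_def mult.assoc)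
  show "cinner x y = cnj (cinner y x)"
    by transfer (simp add: mult.commute flip: Bochner_Integration.integral_cnj)
  show "0 \<le> Re (cinner x x)"
    by transfer (simp add: L2_rel_def complex_norm_square [symmetric] integral_complex_of_real del: of_real_power)
  show "cinner x x = 0 \<longleftrightarrow> x = 0"
  proof transfer
    fix f assume "L2_rel f f"
    then have f: "square_integrable f"
      by (simp add: L2_rel_def)
    have "(\<integral>z. f z * cnj (f z) \<partial>circle) = complex_of_real (\<integral>z. (cmod (f z))\<^sup>2 \<partial>circle)"
      by (simp add: complex_norm_square [symmetric] integral_complex_of_real del: of_real_power)
    moreover have "(\<integral>z. (cmod (f z))\<^sup>2 \<partial>circle) = 0 \<longleftrightarrow> (AE z in circle. (cmod (f z))\<^sup>2 = 0)"
      using f by (intro integral_nonneg_eq_0_iff_AE) (auto simp: square_integrable_def)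
    ultimately show "(\<integral>z. f z * cnj (f z) \<partial>circle) = 0 \<longleftrightarrow> L2_rel f (\<lambda>z. 0)"
      using f by (simp add: L2_rel_def square_integrable_0)
  qed
qed

end


section \<open>The space $L^\infty$ of the circle\<close>

definition essentially_bounded :: "(complex \<Rightarrow> complex) \<Rightarrow> bool" where
  "essentially_bounded \<phi> \<longleftrightarrow>
     \<phi> \<in> borel_measurable circle \<and> (\<exists>B. AE z in circle. cmod (\<phi> z) \<le> B)"

definition Linf_rel :: "(complex \<Rightarrow> complex) \<Rightarrow> (complex \<Rightarrow> complex) \<Rightarrow> bool" where
  "Linf_rel \<phi> \<psi> \<longleftrightarrow>
     essentially_bounded \<phi> \<and> essentially_bounded \<psi> \<and> (AE z in circle. \<phi> z = \<psi> z)"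

lemma essentially_bounded_0: "essentially_bounded (\<lambda>z. 0)"
  by (auto simp: essentially_bounded_def)

lemma essentially_bounded_even:
  assumes "essentially_bounded \<phi>"
  shows "essentially_bounded (\<lambda>z. (\<phi> z + \<phi> (- z)) / 2)"
proof -
  from assms obtain B where m: "\<phi> \<in> borel_measurable circle"
    and B: "AE z in circle. cmod (\<phi> z) \<le> B"
    by (auto simp: essentially_bounded_def)
  have "AE z in circle. cmod ((\<phi> z + \<phi> (- z)) / 2) \<le> B"
    using B AE_circle_uminus[OF B]
  proof eventually_elim
    case (elim z)
    then show ?case
      using norm_triangle_ineq[of "\<phi> z" "\<phi> (- z)"] by (simp add: norm_divide)
  qed
  then show ?thesis
    using m measurable_circle_uminus[OF m] by (auto simp: essentially_bounded_def)
qed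

lemma square_integrable_mult:
  assumes "essentially_bounded \<phi>" "square_integrable f"
  shows "square_integrable (\<lambda>z. \<phi> z * f z)"
proof -
  from assms obtain B where m: "\<phi> \<in> borel_measurable circle" "f \<in> borel_measurable circle"
    and B: "AE z in circle. cmod (\<phi> z) \<le> B"
    and f: "integrable circle (\<lambda>z. (cmod (f z))\<^sup>2)"
    by (auto simp: essentially_bounded_def square_integrable_def)
  have "integrable circle (\<lambda>z. (cmod (\<phi> z * f z))\<^sup>2)"
  proof (rule Bochner_Integration.integrable_bound)
    show "integrable circle (\<lambda>z. B\<^sup>2 * (cmod (f z))\<^sup>2)"
      using f by simp
    show "AE z in circle. norm ((cmod (\<phi> z * f z))\<^sup>2) \<le> norm (B\<^sup>2 * (cmod (f z))\<^sup>2)"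
      using B
    proof eventually_elim
      case (elim z)
      then have "(cmod (\<phi> z))\<^sup>2 \<le> B\<^sup>2"
        by (intro power_mono) simp_all
      then show ?case
        by (simp add: norm_mult power_mult_distrib mult_right_mono)
    qed
  qed (use m in simp)
  then show ?thesis
    using m by (simp add: square_integrable_def)
qed

quotient_type LinfT = "complex \<Rightarrow> complex" / partial: Linf_rel
proof (rule part_equivpI)
  show "\<exists>\<phi>. Linf_rel \<phi> \<phi>"
    using essentially_bounded_0 by (auto simp: Linf_rel_def)
  show "symp Linf_rel"
    by (auto simp: symp_def Linf_rel_def)
  show "transp Linf_rel"
    by (auto simp: transp_def Linf_rel_def)
qed

lift_definition even_Linf :: "LinfT \<Rightarrow> LinfT" is "\<lambda>\<phi> z. (\<phi> z + \<phi> (- z)) / 2"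
proof -
  fix \<phi> \<psi> assume *: "Linf_rel \<phi> \<psi>"
  then have "AE z in circle. \<phi> z = \<psi> z"
    by (simp add: Linf_rel_def)
  from this AE_circle_uminus[OF this]
  have "AE z in circle. (\<phi> z + \<phi> (- z)) / 2 = (\<psi> z + \<psi> (- z)) / 2"
    by eventually_elim simp
  with * show "Linf_rel (\<lambda>z. (\<phi> z + \<phi> (- z)) / 2) (\<lambda>z. (\<psi> z + \<psi> (- z)) / 2)"
    by (simp add: Linf_rel_def essentially_bounded_even)
qed

lift_definition z_square :: LinfT is "\<lambda>z. z\<^sup>2"
  by (auto simp: Linf_rel_def essentially_bounded_def norm_power norm_circle
      intro!: borel_measurable_circle exI[of _ 1] AE_I2)

lift_definition cnj_z_square :: LinfT is "\<lambda>z. (cnj z)\<^sup>2"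
  by (auto simp: Linf_rel_def essentially_bounded_def norm_power norm_circle
      intro!: borel_measurable_circle exI[of _ 1] AE_I2)

text \<open>The relation $|\phi_1|^2 + |\phi_2|^2 = c$ a.e.; it does not depend on the representatives.\<close>

lift_definition norm_square_sum_eq :: "LinfT \<Rightarrow> LinfT \<Rightarrow> real \<Rightarrow> bool" is
  "\<lambda>\<phi>\<^sub>1 \<phi>\<^sub>2 c. AE z in circle. (cmod (\<phi>\<^sub>1 z))\<^sup>2 + (cmod (\<phi>\<^sub>2 z))\<^sup>2 = c"
proof -
  fix \<phi>\<^sub>1 \<psi>\<^sub>1 \<phi>\<^sub>2 \<psi>\<^sub>2 :: "complex \<Rightarrow> complex"
  assume "Linf_rel \<phi>\<^sub>1 \<psi>\<^sub>1" "Linf_rel \<phi>\<^sub>2 \<psi>\<^sub>2"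
  then have "AE z in circle. \<phi>\<^sub>1 z = \<psi>\<^sub>1 z" "AE z in circle. \<phi>\<^sub>2 z = \<psi>\<^sub>2 z"
    by (simp_all add: Linf_rel_def)
  then have "AE z in circle. ((cmod (\<phi>\<^sub>1 z))\<^sup>2 + (cmod (\<phi>\<^sub>2 z))\<^sup>2 = c) =
      ((cmod (\<psi>\<^sub>1 z))\<^sup>2 + (cmod (\<psi>\<^sub>2 z))\<^sup>2 = c)" for c
    by eventually_elim simp
  then show "(\<lambda>c. AE z in circle. (cmod (\<phi>\<^sub>1 z))\<^sup>2 + (cmod (\<phi>\<^sub>2 z))\<^sup>2 = c) =
      (\<lambda>c. AE z in circle. (cmod (\<psi>\<^sub>1 z))\<^sup>2 + (cmod (\<psi>\<^sub>2 z))\<^sup>2 = c)"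
    by (intro ext eventually_subst)
qed


section \<open>Operators on $L^2$\<close>

lift_definition even_part :: "L2T \<Rightarrow> L2T" is "\<lambda>f z. (f z + f (- z)) / 2"
proof -
  fix f g assume *: "L2_rel f g"
  then have "AE z in circle. f z = g z"
    by (simp add: L2_rel_def)
  from this AE_circle_uminus[OF this]
  have "AE z in circle. (f z + f (- z)) / 2 = (g z + g (- z)) / 2"
    by eventually_elim simp
  moreover have "square_integrable (\<lambda>z. (h z + h (- z)) / 2)" if "square_integrable h" for h
    using square_integrable_cmult[OF square_integrable_add[OF that square_integrable_reflect[OF that]], of "1 / 2"]
    by simp
  ultimately show "L2_rel (\<lambda>z. (f z + f (- z)) / 2) (\<lambda>z. (g z + g (- z)) / 2)"
    using * by (simp add: L2_rel_def)
qed

lift_definition odd_part :: "L2T \<Rightarrow> L2T" is "\<lambda>f z. (f z - f (- z)) / 2"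
proof -
  fix f g assume *: "L2_rel f g"
  then have "AE z in circle. f z = g z"
    by (simp add: L2_rel_def)
  from this AE_circle_uminus[OF this]
  have "AE z in circle. (f z - f (- z)) / 2 = (g z - g (- z)) / 2"
    by eventually_elim simp
  moreover have "square_integrable (\<lambda>z. (h z - h (- z)) / 2)" if "square_integrable h" for h
    using square_integrable_cmult[OF square_integrable_diff[OF that square_integrable_reflect[OF that]], of "1 / 2"]
    by simp
  ultimately show "L2_rel (\<lambda>z. (f z - f (- z)) / 2) (\<lambda>z. (g z - g (- z)) / 2)"
    using * by (simp add: L2_rel_def)
qed

lift_definition mult_op :: "LinfT \<Rightarrow> L2T \<Rightarrow> L2T" is "\<lambda>\<phi> f z. \<phi> z * f z"
proof -
  fix \<phi> \<psi> f g assume *: "Linf_rel \<phi> \<psi>" "L2_rel f g"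
  then have "AE z in circle. \<phi> z = \<psi> z" "AE z in circle. f z = g z"
    by (simp_all add: Linf_rel_def L2_rel_def)
  then have "AE z in circle. \<phi> z * f z = \<psi> z * g z"
    by eventually_elim simp
  with * show "L2_rel (\<lambda>z. \<phi> z * f z) (\<lambda>z. \<psi> z * g z)"
    by (simp add: L2_rel_def Linf_rel_def square_integrable_mult)
qed

definition mult_op2 :: "LinfT \<Rightarrow> LinfT \<Rightarrow> L2T \<Rightarrow> L2T" where
  "mult_op2 \<phi>\<^sub>1 \<phi>\<^sub>2 f = mult_op \<phi>\<^sub>1 (even_part f) + mult_op \<phi>\<^sub>2 (odd_part f)"

lift_definition conj_z2 :: "L2T \<Rightarrow> L2T" is "\<lambda>f z. z * cnj (f z)"
proof -
  fix f g assume *: "L2_rel f g"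
  have "square_integrable (\<lambda>z. z * cnj (h z))" if "square_integrable h" for h
  proof (rule square_integrable_bound)
    show "(\<lambda>z. z * cnj (h z)) \<in> borel_measurable circle"
      using that unfolding square_integrable_def
      by (intro borel_measurable_times borel_measurable_circle[of "\<lambda>z. z"] borel_measurable_cnj) simp_all
    show "integrable circle (\<lambda>z. (cmod (h z))\<^sup>2)"
      using that by (simp add: square_integrable_def)
  qed (simp add: norm_mult norm_circle)
  moreover have "AE z in circle. z * cnj (f z) = z * cnj (g z)"
    using * unfolding L2_rel_def by auto
  ultimately show "L2_rel (\<lambda>z. z * cnj (f z)) (\<lambda>z. z * cnj (g z))"
    using * by (simp add: L2_rel_def)
qed

end

theory Submission
  imports Defs
begin

text \<open>Let $J f = z \overline{f}$ and $A = C J$. Then $A$ is a surjective isometry commuting with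
  $M_{z^2}$, so it is determined by $u = A 1$ and $v = \overline{z} A z$: it sends $z^{2n}$ to
  $u z^{2n}$ and $z^{2n+1}$ to $v z^{2n+1}$. Comparing inner products of these images and using
  uniqueness of Fourier coefficients in $L^1$ gives, almost everywhere,
  $|u(z)|^2 + |u(-z)|^2 = 2 = |v(z)|^2 + |v(-z)|^2$ and
  $u(z) \overline{v(z)} = u(-z) \overline{v(-z)}$, while the symmetry
  $\langle C f, g\rangle = \langle C g, f\rangle$ gives $u^e = v^e$. These relations imply
  $|u|^2 + |v|^2 = 2$ and make $M_{[u,v]}$ isometric. As $M_{[u,v]}$ agrees with $A$ on every
  $z^k$, the vector $A f - M_{[u,v]} f$ is orthogonal to all $A z^k$; it has the form $A g$, so $g$ is
  orthogonal to all $z^k$, hence zero.\<close>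

section \<open>Uniqueness of Fourier coefficients\<close>

lemma AE_circleI: "(\<And>z. cmod z = 1 \<Longrightarrow> P z) \<Longrightarrow> AE z in circle. P z"
  by (rule AE_I2) (simp add: norm_circle)

lemma borel_measurable_circle_id [measurable]: "(\<lambda>z. z) \<in> borel_measurable circle"
  by (rule borel_measurable_circle) simp

lemma borel_measurable_circle_powi [measurable]: "(\<lambda>z. z powi k) \<in> borel_measurable circle"
  by (cases k rule: int_cases2) (auto simp: power_int_minus)

lemma unit_nonzero: "cmod z = 1 \<Longrightarrow> z \<noteq> 0"
  by auto

lemma cnj_eq_inverse:
  assumes "cmod z = 1"
  shows "cnj z = inverse z"
  using assms by (auto simp: inverse_complex_def cmod_def complex_eq_iff)

lemma cnj_powi:
  assumes "cmod z = 1"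
  shows "cnj (z powi k) = z powi (- k)"
  by (cases k rule: int_cases2) (auto simp: power_int_minus cnj_eq_inverse assms power_inverse)

text \<open>An L^1 function times a bounded one; used for powers of z and for the error of a uniform
  approximation.\<close>

lemma integrable_circle_bounded_mult:
  fixes g h :: "complex \<Rightarrow> complex"
  assumes "integrable circle h" "g \<in> borel_measurable circle" "\<And>z. cmod z = 1 \<Longrightarrow> cmod (g z) \<le> B"
  shows "integrable circle (\<lambda>z. h z * g z)"
proof (rule Bochner_Integration.integrable_bound)
  show "integrable circle (\<lambda>z. B * norm (h z))"
    using assms(1) by simp
  show "AE z in circle. norm (h z * g z) \<le> norm (B * norm (h z))"
  proof (rule AE_circleI)
    fix z :: complex assume "cmod z = 1"
    then have "norm (h z) * norm (g z) \<le> norm (h z) * B"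
      by (intro mult_left_mono assms) simp_all
    also have "\<dots> \<le> norm (B * norm (h z))"
      by (simp add: mult.commute)
    finally show "norm (h z * g z) \<le> norm (B * norm (h z))"
      by (simp add: norm_mult)
  qed
qed (use assms in simp)

lemma integrable_circle_powi:
  fixes h :: "complex \<Rightarrow> complex"
  assumes "integrable circle h"
  shows "integrable circle (\<lambda>z. h z * z powi k)"
  using assms by (rule integrable_circle_bounded_mult[where B=1]) (auto simp: norm_power_int)

text \<open>The map z -> -z preserves the measure \<open>circle\<close>.\<close>

lemma integral_circle_reflect:
  fixes f :: "complex \<Rightarrow> complex"
  assumes "f \<in> borel_measurable circle"
  shows "(\<integral>z. f (- z) \<partial>circle) = (\<integral>z. f z \<partial>circle)"
  using integral_distr[OF uminus_circle assms] by (simp add: distr_circle_uminus)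

lemma integrable_circle_reflect:
  fixes f :: "complex \<Rightarrow> complex"
  assumes "integrable circle f"
  shows "integrable circle (\<lambda>z. f (- z))"
  using integrable_distr[OF uminus_circle, of f] assms by (simp add: distr_circle_uminus)

text \<open>All integers k occur, so z^k may stand in place of its conjugate. Integrability is
  included because the Bochner integral of a non-integrable function is 0 by default.\<close>

definition zero_coeffs :: "(complex \<Rightarrow> complex) \<Rightarrow> bool" where
  "zero_coeffs h \<longleftrightarrow> integrable circle h \<and> (\<forall>k. (\<integral>z. h z * z powi k \<partial>circle) = 0)"

lemma zero_coeffs_integral: "zero_coeffs h \<Longrightarrow> (\<integral>z. h z \<partial>circle) = 0"
  unfolding zero_coeffs_def by (auto dest: spec[of _ 0])

lemma zero_coeffs_add:
  assumes "zero_coeffs g" "zero_coeffs h"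
  shows "zero_coeffs (\<lambda>z. g z + h z)"
  using assms unfolding zero_coeffs_def by (simp add: distrib_right integrable_circle_powi)

lemma zero_coeffs_cmult: "zero_coeffs h \<Longrightarrow> zero_coeffs (\<lambda>z. h z * c)"
  by (simp add: zero_coeffs_def mult.assoc mult.left_commute[of _ c])

text \<open>A factor z^j shifts the coefficients by j. The law of exponents requires z \<noteq> 0,
  which holds on the circle.\<close>

lemma zero_coeffs_powi:
  assumes "zero_coeffs h"
  shows "zero_coeffs (\<lambda>z. h z * z powi j)"
proof -
  have "(\<integral>z. h z * z powi j * z powi k \<partial>circle) = (\<integral>z. h z * z powi (j + k) \<partial>circle)" for k
  proof (rule integral_cong_AE)
    show "AE z in circle. h z * z powi j * z powi k = h z * z powi (j + k)"
      by (rule AE_circleI) (subst power_int_add, auto)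
  qed (use assms in \<open>auto simp: zero_coeffs_def\<close>)
  then show ?thesis
    using assms by (simp add: zero_coeffs_def integrable_circle_powi)
qed

lemma zero_coeffs_cong:
  assumes "zero_coeffs g" "h \<in> borel_measurable circle" "AE z in circle. g z = h z"
  shows "zero_coeffs h"
proof -
  have g: "integrable circle g"
    using assms by (simp add: zero_coeffs_def)
  then have "integrable circle h"
    using assms by (subst integrable_cong_AE[where g=g]) auto
  moreover have "(\<integral>z. h z * z powi k \<partial>circle) = (\<integral>z. g z * z powi k \<partial>circle)" for k
    using assms g by (intro integral_cong_AE) auto
  ultimately show ?thesis
    using assms by (simp add: zero_coeffs_def)
qed

section \<open>From trigonometric polynomials to continuous functions, closed sets and Borel
  sets\<close>

lemma real_polynomial_function_measurable_circle:
  fixes p :: "complex \<Rightarrow> real"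
  shows "real_polynomial_function p \<Longrightarrow> p \<in> borel_measurable circle"
  by (intro borel_measurable_circle borel_measurable_continuous_onI continuous_on_polymonial_function)
    (simp add: real_polynomial_function_eq)

text \<open>On the circle a real polynomial is a trigonometric one, and multiplying by $z^{\pm 1}$ only
  shifts the coefficients, so all of them stay zero.\<close>

lemma zero_coeffs_real_polynomial_function:
  fixes p :: "complex \<Rightarrow> real"
  assumes "real_polynomial_function p" "zero_coeffs h"
  shows "zero_coeffs (\<lambda>z. h z * complex_of_real (p z))"
  using assms
proof (induction p arbitrary: h rule: real_polynomial_function.induct)
  case (linear f)
  interpret bounded_linear f by fact
  \<comment> \<open>A real-linear form on the plane is 2 Re (a z) with a = (f(1) - i f(i)) /
    2.\<close>
  define a where "a = Complex (f 1 / 2) (- f \<i> / 2)"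
  have f: "complex_of_real (f z) = a * z + cnj a * cnj z" for z
  proof -
    have "f z = f (Re z *\<^sub>R 1 + Im z *\<^sub>R \<i>)"
      by (rule arg_cong[where f=f]) (simp add: complex_eq_iff)
    also have "\<dots> = Re z * f 1 + Im z * f \<i>"
      by (simp only: add scale real_scaleR_def)
    finally show ?thesis
      by (simp add: complex_eq_iff a_def)
  qed
  \<comment> \<open>On the circle \<open>cnj z\<close> is z^(-1), so multiplying by f combines the
    shifts by 1 and -1.\<close>
  have "zero_coeffs (\<lambda>z. h z * z powi 1 * a + h z * z powi (- 1) * cnj a)"
    using linear.prems by (intro zero_coeffs_add zero_coeffs_cmult zero_coeffs_powi)
  then show ?case
  proof (rule zero_coeffs_cong)
    have "f \<in> borel_measurable circle"
      by (intro real_polynomial_function_measurable_circle real_polynomial_function.intros(1) linear.hyps)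
    then show "(\<lambda>z. h z * complex_of_real (f z)) \<in> borel_measurable circle"
      using linear.prems by (auto simp: zero_coeffs_def)
    show "AE z in circle. h z * z powi 1 * a + h z * z powi (- 1) * cnj a = h z * complex_of_real (f z)"
      by (rule AE_circleI) (simp add: f cnj_eq_inverse algebra_simps power_int_minus)
  qed
next
  case (const c)
  then show ?case by (intro zero_coeffs_cmult)
next
  case (add f g)
  then show ?case by (simp add: distrib_left zero_coeffs_add)
next
  \<comment> \<open>The hypothesis for g is applied to h f instead of h; hence the induction
    generalises over h.\<close>
  case (mult f g)
  then show ?case by (simp add: mult.assoc [symmetric])
qed

text \<open>By Stone-Weierstrass a polynomial p is uniformly within e of g on the circle. The
  integral of h p vanishes and the error is at most e times the L^1 norm of h.\<close>

lemma zero_coeffs_integral_continuous: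
  fixes g :: "complex \<Rightarrow> real"
  assumes h: "zero_coeffs h" and g: "continuous_on UNIV g"
  shows "(\<integral>z. h z * complex_of_real (g z) \<partial>circle) = 0"
proof -
  let ?N = "\<integral>z. norm (h z) \<partial>circle"
  have hi: "integrable circle h"
    using h by (simp add: zero_coeffs_def)
  have gm: "g \<in> borel_measurable circle"
    using g by (intro borel_measurable_circle borel_measurable_continuous_onI)
  have bound: "norm (\<integral>z. h z * complex_of_real (g z) \<partial>circle) \<le> e * ?N" if e: "e > 0" for e
  proof -
    obtain p where p: "real_polynomial_function p"
        "\<And>z. z \<in> sphere 0 1 \<Longrightarrow> \<bar>g z - p z\<bar> < e"
      using Stone_Weierstrass_real_polynomial_function
          [OF compact_sphere continuous_on_subset[OF g subset_UNIV] e, of 0 1] by blast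
    have pm: "p \<in> borel_measurable circle"
      using p by (intro real_polynomial_function_measurable_circle)
    have zp: "zero_coeffs (\<lambda>z. h z * complex_of_real (p z))"
      using p(1) h by (rule zero_coeffs_real_polynomial_function)
    have le: "cmod (complex_of_real (g z - p z)) \<le> e" if "cmod z = 1" for z
      using p(2)[of z] that by (simp del: of_real_diff)
    have int: "integrable circle (\<lambda>z. h z * complex_of_real (g z - p z))"
      using hi gm pm le by (intro integrable_circle_bounded_mult) auto
    have "(\<integral>z. h z * complex_of_real (g z) \<partial>circle) =
        (\<integral>z. h z * complex_of_real (g z - p z) + h z * complex_of_real (p z) \<partial>circle)"
      by (simp add: algebra_simps)
    also have "\<dots> = (\<integral>z. h z * complex_of_real (g z - p z) \<partial>circle) + 0"
      using zp int zero_coeffs_integral[OF zp]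
      by (subst Bochner_Integration.integral_add) (simp_all add: zero_coeffs_def)
    also have "norm \<dots> \<le> (\<integral>z. e * norm (h z) \<partial>circle)"
    proof -
      have "norm (h z * complex_of_real (g z - p z)) \<le> e * norm (h z)" if "cmod z = 1" for z
        unfolding norm_mult using mult_left_mono[OF le[OF that], of "norm (h z)"]
        by (simp only: mult.commute norm_ge_zero)
      then have "(\<integral>z. norm (h z * complex_of_real (g z - p z)) \<partial>circle) \<le> (\<integral>z. e * norm (h z) \<partial>circle)"
        by (intro integral_mono_AE integrable_norm int integrable_mult_right hi AE_circleI)
      then show ?thesis
        unfolding add_0_right by (rule order_trans[OF integral_norm_bound])
    qed
    finally show ?thesis by simp
  qed
  have "norm (\<integral>z. h z * complex_of_real (g z) \<partial>circle) \<le> 0"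
  proof (rule field_le_epsilon)
    fix e :: real assume e: "e > 0"
    have N: "?N \<ge> 0" by simp
    \<comment> \<open>The denominator \<open>?N + 1\<close> is positive even if h vanishes almost
      everywhere.\<close>
    have "norm (\<integral>z. h z * complex_of_real (g z) \<partial>circle) \<le> e / (?N + 1) * ?N"
      using e N by (intro bound divide_pos_pos) linarith+
    also have "\<dots> = e * (?N / (?N + 1))"
      by simp
    also have "\<dots> \<le> e"
    proof (rule mult_left_le)
      show "?N / (?N + 1) \<le> 1"
        unfolding divide_le_eq_1 using N by linarith
    qed (use e in linarith)
    finally show "norm (\<integral>z. h z * complex_of_real (g z) \<partial>circle) \<le> 0 + e" by simp
  qed
  then show ?thesis by simp
qed

text \<open>The indicator of K is a pointwise limit of continuous functions with values in [0,1], so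
  dominated convergence applies with the bound |h|.\<close>

lemma zero_coeffs_integral_closed:
  assumes h: "zero_coeffs h" and K: "closed K"
  shows "(\<integral>z. indicator K z *\<^sub>R h z \<partial>circle) = 0"
proof (cases "K = {}")
  \<comment> \<open>For empty K, \<open>infdist\<close> is 0 by convention, and the functions below
    would be constantly 1.\<close>
  case False
  have hi: "integrable circle h"
    using h by (simp add: zero_coeffs_def)
  define g where "g n z = max 0 (1 - real n * infdist z K)" for n and z :: complex
  have gc: "continuous_on UNIV (g n)" for n
    unfolding g_def by (intro continuous_intros)
  have lim: "(\<lambda>n. g n z) \<longlonglongrightarrow> indicator K z" for z
  proof (cases "z \<in> K")
    case True
    then show ?thesis by (simp add: g_def)
  next
    case z: False
    then have pos: "infdist z K > 0"
      using K False by (metis in_closed_iff_infdist_zero infdist_nonneg order_le_less)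
    have "eventually (\<lambda>n. 1 < real n * infdist z K) sequentially"
      using filterlim_at_top_mult_tendsto_pos[OF tendsto_const pos filterlim_real_sequentially]
      by (simp add: filterlim_at_top_dense mult.commute)
    then have "eventually (\<lambda>n. g n z = 0) sequentially"
      by eventually_elim (simp add: g_def)
    then show ?thesis
      using z by (simp add: tendsto_eventually)
  qed
  have "(\<lambda>n. \<integral>z. h z * complex_of_real (g n z) \<partial>circle) \<longlonglongrightarrow> (\<integral>z. indicator K z *\<^sub>R h z \<partial>circle)"
  proof (rule integral_dominated_convergence[where w="\<lambda>z. norm (h z)"])
    have "indicat_real K \<in> borel_measurable circle"
      using K by (intro borel_measurable_circle borel_measurable_indicator) auto
    then show "(\<lambda>z. indicator K z *\<^sub>R h z) \<in> borel_measurable circle"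
      using hi by auto
    show "(\<lambda>z. h z * complex_of_real (g n z)) \<in> borel_measurable circle" for n
      using hi borel_measurable_circle[OF borel_measurable_continuous_onI[OF gc]] by auto
    show "AE z in circle. (\<lambda>n. h z * complex_of_real (g n z)) \<longlonglongrightarrow> indicator K z *\<^sub>R h z"
      using tendsto_mult[OF tendsto_const tendsto_of_real[OF lim]]
      by (auto simp: scaleR_conv_of_real mult.commute)
    show "AE z in circle. norm (h z * complex_of_real (g n z)) \<le> norm (h z)" for n
      by (intro AE_I2) (auto simp: norm_mult g_def infdist_nonneg intro!: mult_left_le)
  qed (use hi in simp)
  then show ?thesis
    unfolding zero_coeffs_integral_continuous[OF h gc] by (metis LIMSEQ_unique tendsto_const)
qed simp

text \<open>The closed sets are stable under intersection and generate the Borel sets, so h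
  integrates to 0 over every Borel set; an integrable function with this property vanishes almost
  everywhere.\<close>

lemma zero_coeffs_AE_zero:
  assumes h: "zero_coeffs h"
  shows "AE z in circle. h z = 0"
proof -
  have hi: "integrable circle h"
    using h by (simp add: zero_coeffs_def)
  \<comment> \<open>The measurable sets of \<open>circle\<close> lie inside the circle, so a Borel
    set of the plane is first cut down to it.\<close>
  have si: "set_integrable circle A h" if "A \<in> sets borel" for A
  proof -
    have "A \<inter> space circle \<in> sets circle"
      using that by (auto simp: sets_circle sets_restrict_space space_circle)
    then have "integrable circle (\<lambda>z. indicator (A \<inter> space circle) z *\<^sub>R h z)"
      using hi by (rule integrable_mult_indicator)
    then show ?thesis
      unfolding set_integrable_def
      by (subst Bochner_Integration.integrable_cong[OF refl, where g="\<lambda>z. indicator (A \<inter> space circle) z *\<^sub>R h z"])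
        (auto simp: indicator_def)
  qed
  have "Int_stable (Collect closed :: complex set set)" "(Collect closed :: complex set set) \<subseteq> Pow UNIV"
    by (auto simp: Int_stable_def)
  then have "(\<integral>z. indicator A z *\<^sub>R h z \<partial>circle) = 0" if "A \<in> sigma_sets UNIV (Collect closed)" for A
    using that
  proof (induction A rule: sigma_sets_induct_disjoint)
    case (basic A)
    then show ?case using zero_coeffs_integral_closed[OF h] by simp
  next
    case (compl A)
    then have "A \<in> sets borel"
      by (simp add: borel_eq_closed)
    then have "integrable circle (\<lambda>z. indicator A z *\<^sub>R h z)"
      using si by (simp add: set_integrable_def)
    moreover have "indicator (UNIV - A) z *\<^sub>R h z = h z - indicator A z *\<^sub>R h z" for z
      by (simp add: indicator_def)
    ultimately show ?case
      using hi compl zero_coeffs_integral[OF h] by simp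
  next
    case (union A)
    let ?I = "\<lambda>i z. indicator (A i) z *\<^sub>R h z"
    have bor: "A i \<in> sets borel" for i
      using union by (auto simp: borel_eq_closed)
    \<comment> \<open>Dominated convergence reduces the countable union to finite ones, where
      disjointness turns the indicator into a sum.\<close>
    have "(\<lambda>n. \<integral>z. indicator (\<Union>i<n. A i) z *\<^sub>R h z \<partial>circle) \<longlonglongrightarrow>
        (\<integral>z. indicator (\<Union>i. A i) z *\<^sub>R h z \<partial>circle)"
    proof (rule integral_dominated_convergence[where w="\<lambda>z. norm (h z)"])
      show "(\<lambda>z. indicator (\<Union>i. A i) z *\<^sub>R h z) \<in> borel_measurable circle"
        using si[of "\<Union>i. A i"] bor by (auto simp: set_integrable_def)
      show "(\<lambda>z. indicator (\<Union>i<n. A i) z *\<^sub>R h z) \<in> borel_measurable circle" for n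
        using si[of "\<Union>i<n. A i"] bor by (auto simp: set_integrable_def)
      show "AE z in circle. (\<lambda>n. indicator (\<Union>i<n. A i) z *\<^sub>R h z) \<longlonglongrightarrow> indicator (\<Union>i. A i) z *\<^sub>R h z"
        by (intro AE_I2 tendsto_scaleR tendsto_const LIMSEQ_indicator_UN)
      show "AE z in circle. norm (indicator (\<Union>i<n. A i) z *\<^sub>R h z) \<le> norm (h z)" for n
        by (auto simp: indicator_def)
    qed (use hi in simp)
    moreover have "(\<integral>z. indicator (\<Union>i<n. A i) z *\<^sub>R h z \<partial>circle) = 0" for n
    proof -
      have "indicator (\<Union>i<n. A i) z = (\<Sum>i<n. indicat_real (A i) z)" for z
        by (rule indicator_UN_disjoint) (use union in \<open>auto simp: disjoint_family_on_def\<close>)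
      then have "(\<integral>z. indicator (\<Union>i<n. A i) z *\<^sub>R h z \<partial>circle) = (\<integral>z. (\<Sum>i<n. ?I i z) \<partial>circle)"
        by (simp add: scaleR_sum_left)
      also have "\<dots> = (\<Sum>i<n. \<integral>z. ?I i z \<partial>circle)"
        using si[OF bor] by (intro Bochner_Integration.integral_sum) (simp add: set_integrable_def)
      finally show ?thesis
        using union by simp
    qed
    ultimately show ?case
      by (simp add: LIMSEQ_const_iff)
  qed simp
  then have *: "(\<integral>z. indicator A z *\<^sub>R h z \<partial>circle) = 0" if "A \<in> sets borel" for A
    using that by (simp add: borel_eq_closed)
  show ?thesis
  proof (rule circle.density_zero[OF hi])
    fix A assume "A \<in> sets circle"
    then have "A \<in> sets borel"
      by (auto simp: sets_circle sets_restrict_space)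
    then show "set_lebesgue_integral circle A h = 0"
      using * by (simp add: set_lebesgue_integral_def)
  qed
qed

text \<open>Symmetrisation removes the odd coefficients. Thus inner products with even exponent
  differences yield pointwise relations between the values at z and -z.\<close>

lemma even_coeffs_zero_AE:
  fixes f :: "complex \<Rightarrow> complex"
  assumes f: "integrable circle f" and z: "\<And>n. (\<integral>z. f z * z powi (2 * n) \<partial>circle) = 0"
  shows "AE z in circle. f z + f (- z) = 0"
proof (rule zero_coeffs_AE_zero)
  note f' = integrable_circle_reflect[OF f]
  have "(\<integral>z. (f z + f (- z)) * z powi k \<partial>circle) = 0" for k
  proof -
    have r: "(\<integral>z. f (- z) * (- z) powi k \<partial>circle) = (\<integral>z. f z * z powi k \<partial>circle)"
      using f by (subst integral_circle_reflect[where f="\<lambda>z. f z * z powi k"]) auto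
    have "(\<integral>z. (f z + f (- z)) * z powi k \<partial>circle) =
        (\<integral>z. f z * z powi k \<partial>circle) + (\<integral>z. f (- z) * z powi k \<partial>circle)"
      using f f' by (simp add: distrib_right integrable_circle_powi)
    also have "\<dots> = 0"
    \<comment> \<open>Since (-z)^k is z^k or -z^k, the two integrals agree for even k, where both
      vanish, and cancel for odd k.\<close>
    proof (cases "even k")
      case True
      then show ?thesis using r z by (auto elim!: evenE)
    next
      case False
      then show ?thesis using r by (simp add: neg_eq_iff_add_eq_0 add.commute)
    qed
    finally show ?thesis .
  qed
  then show "zero_coeffs (\<lambda>z. f z + f (- z))"
    using f f' by (simp add: zero_coeffs_def)
qed


section \<open>Operators on representatives\<close>

text \<open>\<open>L2T\<close> is a partial quotient: only square integrable functions represent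
  elements, which is why this condition accompanies every computation below.\<close>

lemma abs_L2T_eq_iff:
  assumes "square_integrable f" "square_integrable g"
  shows "abs_L2T f = abs_L2T g \<longleftrightarrow> (AE z in circle. f z = g z)"
  using assms Quotient3_rel[OF Quotient3_L2T, of f g] by (auto simp: L2_rel_def)

lemma abs_L2T_eqI:
  assumes "square_integrable f" "square_integrable g" "\<And>z. cmod z = 1 \<Longrightarrow> f z = g z"
  shows "abs_L2T f = abs_L2T g"
  using assms by (simp add: abs_L2T_eq_iff AE_circleI)

lemma L2T_cases:
  obtains f where "square_integrable f" "F = abs_L2T f"
  using Quotient3_abs_rep[OF Quotient3_L2T, of F] Quotient3_rep_reflp[OF Quotient3_L2T, of F]
  by (metis L2_rel_def)

lemma cinner_abs_L2T:
  assumes "square_integrable f" "square_integrable g"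
  shows "cinner (abs_L2T f) (abs_L2T g) = (\<integral>z. f z * cnj (g z) \<partial>circle)"
  using assms by (intro cinner_L2T.abs_eq) (simp_all add: L2_rel_def)

lemma mult_op_abs:
  assumes "essentially_bounded \<phi>" "square_integrable f"
  shows "mult_op (abs_LinfT \<phi>) (abs_L2T f) = abs_L2T (\<lambda>z. \<phi> z * f z)"
  using assms by (intro mult_op.abs_eq) (simp_all add: L2_rel_def Linf_rel_def)

lemma essentially_boundedI:
  assumes "f \<in> borel_measurable circle" "\<And>z. cmod z = 1 \<Longrightarrow> cmod (f z) \<le> B"
  shows "essentially_bounded f"
  using assms by (auto simp: essentially_bounded_def intro!: AE_circleI exI[of _ B])

lemma essentially_bounded_powi: "essentially_bounded (\<lambda>z. z powi k)"
  by (rule essentially_boundedI[where B=1]) (auto simp: norm_power_int)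

lemma square_integrable_powi: "square_integrable f \<Longrightarrow> square_integrable (\<lambda>z. f z * z powi k)"
  using square_integrable_mult[OF essentially_bounded_powi] by (simp add: mult.commute)

lemma square_integrable_1: "square_integrable (\<lambda>z. 1)"
  by (simp add: square_integrable_def)

lemma z_square_abs:
  assumes "square_integrable f"
  shows "mult_op z_square (abs_L2T f) = abs_L2T (\<lambda>z. z\<^sup>2 * f z)"
  unfolding z_square_def using essentially_bounded_powi[of 2] assms
  by (intro mult_op_abs) simp_all

lemma essentially_bounded_cnj_square: "essentially_bounded (\<lambda>z. (cnj z)\<^sup>2)"
  by (rule essentially_boundedI[where B=1]) (auto simp: norm_power)

lemma cnj_z_square_abs:
  assumes "square_integrable f"
  shows "mult_op cnj_z_square (abs_L2T f) = abs_L2T (\<lambda>z. (cnj z)\<^sup>2 * f z)"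
  unfolding cnj_z_square_def using assms
  by (intro mult_op_abs essentially_bounded_cnj_square)

lemma cnj_square_mult_square: "cmod z = 1 \<Longrightarrow> (cnj z)\<^sup>2 * (z\<^sup>2 * w) = w"
  by (simp add: cnj_eq_inverse power_inverse unit_nonzero)

lemma square_mult_cnj_square: "cmod z = 1 \<Longrightarrow> z\<^sup>2 * ((cnj z)\<^sup>2 * w) = w"
  by (simp add: cnj_eq_inverse power_inverse unit_nonzero)

lemma square_integrable_square: "square_integrable f \<Longrightarrow> square_integrable (\<lambda>z. z\<^sup>2 * f z)"
  using square_integrable_powi[of f 2] by (simp add: mult.commute)

text \<open>As |z| = 1, the two multiplications invert each other; this direction allows cancelling
  \<open>mult_op z_square\<close>.\<close>

lemma cnj_z_square_z_square: "mult_op cnj_z_square (mult_op z_square F) = F"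
proof (cases F rule: L2T_cases)
  case (1 f)
  then show ?thesis
    by (auto simp: z_square_abs cnj_z_square_abs square_integrable_square cnj_square_mult_square
        intro!: abs_L2T_eqI square_integrable_mult[OF essentially_bounded_cnj_square])
qed

lemma z_square_cnj_z_square: "mult_op z_square (mult_op cnj_z_square F) = F"
proof (cases F rule: L2T_cases)
  case (1 f)
  then have "square_integrable (\<lambda>z. (cnj z)\<^sup>2 * f z)"
    by (intro square_integrable_mult essentially_bounded_cnj_square)
  then show ?thesis
    using 1 by (auto simp: z_square_abs cnj_z_square_abs square_mult_cnj_square
        intro!: abs_L2T_eqI square_integrable_square)
qed

lemma square_integrable_conj_z2:
  assumes "square_integrable f"
  shows "square_integrable (\<lambda>z. z * cnj (f z))"
proof (rule square_integrable_bound)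
  show "integrable circle (\<lambda>z. (cmod (f z))\<^sup>2)" "(\<lambda>z. z * cnj (f z)) \<in> borel_measurable circle"
    using assms by (auto simp: square_integrable_def)
qed (simp add: norm_mult norm_circle)

lemma conj_z2_abs:
  assumes "square_integrable f"
  shows "conj_z2 (abs_L2T f) = abs_L2T (\<lambda>z. z * cnj (f z))"
  using assms by (intro conj_z2.abs_eq) (simp add: L2_rel_def)

lemma conj_z2_conj_z2: "conj_z2 (conj_z2 F) = F"
proof (cases F rule: L2T_cases)
  case (1 f)
  then show ?thesis
    by (simp add: conj_z2_abs square_integrable_conj_z2 del: complex_cnj_mult)
      (rule abs_L2T_eqI[OF square_integrable_conj_z2[OF square_integrable_conj_z2]],
        simp_all add: cnj_eq_inverse unit_nonzero)
qed

text \<open>The factors z and \<open>cnj z\<close> cancel on the circle. As C swaps the arguments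
  too, composing it with \<open>conj_z2\<close> gives an isometry.\<close>

lemma cinner_conj_z2: "cinner (conj_z2 F) (conj_z2 G) = cinner G F"
proof (cases F rule: L2T_cases)
  case f: (1 f)
  show ?thesis
  proof (cases G rule: L2T_cases)
    case g: (1 g)
    have "(\<integral>z. z * cnj (f z) * cnj (z * cnj (g z)) \<partial>circle) = (\<integral>z. g z * cnj (f z) \<partial>circle)"
      by (rule Bochner_Integration.integral_cong)
        (auto simp: cnj_eq_inverse unit_nonzero dest!: norm_circle)
    then show ?thesis
      using f g by (simp add: conj_z2_abs cinner_abs_L2T square_integrable_conj_z2)
  qed
qed

lemma conj_z2_z_square: "conj_z2 (mult_op z_square F) = mult_op cnj_z_square (conj_z2 F)"
proof (cases F rule: L2T_cases)
  case (1 f)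
  then show ?thesis
    by (simp add: conj_z2_abs z_square_abs cnj_z_square_abs square_integrable_conj_z2
        square_integrable_square del: complex_cnj_mult)
      (rule abs_L2T_eqI; simp add: square_integrable_conj_z2 square_integrable_square
        square_integrable_mult[OF essentially_bounded_cnj_square] del: complex_cnj_mult; simp)
qed

lemma square_integrable_even_part:
  "square_integrable f \<Longrightarrow> square_integrable (\<lambda>z. (f z + f (- z)) / 2)"
  using square_integrable_cmult[OF square_integrable_add[OF _ square_integrable_reflect], of f f "1 / 2"]
  by simp

lemma square_integrable_odd_part:
  "square_integrable f \<Longrightarrow> square_integrable (\<lambda>z. (f z - f (- z)) / 2)"
  using square_integrable_cmult[OF square_integrable_diff[OF _ square_integrable_reflect], of f f "1 / 2"]
  by simp

lemma mult_op2_abs: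
  assumes "essentially_bounded \<phi>" "essentially_bounded \<psi>" "square_integrable f"
  shows "mult_op2 (abs_LinfT \<phi>) (abs_LinfT \<psi>) (abs_L2T f) =
      abs_L2T (\<lambda>z. \<phi> z * ((f z + f (- z)) / 2) + \<psi> z * ((f z - f (- z)) / 2))" (is ?eq)
    and "square_integrable (\<lambda>z. \<phi> z * ((f z + f (- z)) / 2) + \<psi> z * ((f z - f (- z)) / 2))" (is ?si)
proof -
  note e = square_integrable_even_part[OF assms(3)] and o = square_integrable_odd_part[OF assms(3)]
  have "even_part (abs_L2T f) = abs_L2T (\<lambda>z. (f z + f (- z)) / 2)"
    using assms by (intro even_part.abs_eq) (simp add: L2_rel_def)
  moreover have "odd_part (abs_L2T f) = abs_L2T (\<lambda>z. (f z - f (- z)) / 2)"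
    using assms by (intro odd_part.abs_eq) (simp add: L2_rel_def)
  ultimately show ?eq
    using assms e o square_integrable_mult[OF assms(1) e] square_integrable_mult[OF assms(2) o]
    by (simp add: mult_op2_def mult_op_abs plus_L2T.abs_eq L2_rel_def del: times_divide_eq_right)
  show ?si
    by (intro square_integrable_add square_integrable_mult assms e o)
qed

lemma LinfT_cases:
  obtains \<phi> where "essentially_bounded \<phi>" "\<Phi> = abs_LinfT \<phi>"
  using Quotient3_abs_rep[OF Quotient3_LinfT, of \<Phi>] Quotient3_rep_reflp[OF Quotient3_LinfT, of \<Phi>]
  by (metis Linf_rel_def)

text \<open>The function \<open>(cnj z)\<^sup>2\<close> is even, so multiplying by it commutes with
  taking even and odd parts.\<close>

lemma mult_op2_cnj_z_square:
  "mult_op2 \<Phi> \<Psi> (mult_op cnj_z_square F) = mult_op cnj_z_square (mult_op2 \<Phi> \<Psi> F)"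
proof (cases \<Phi> rule: LinfT_cases)
  case \<phi>: (1 \<phi>)
  show ?thesis
  proof (cases \<Psi> rule: LinfT_cases)
    case \<psi>: (1 \<psi>)
    show ?thesis
    proof (cases F rule: L2T_cases)
      case f: (1 f)
      have g: "square_integrable (\<lambda>z. (cnj z)\<^sup>2 * f z)"
        using f by (intro square_integrable_mult essentially_bounded_cnj_square)
      note bd = \<phi>(1) \<psi>(1)
      show ?thesis
        unfolding \<phi>(2) \<psi>(2) f(2)
        unfolding mult_op2_abs(1)[OF bd f(1)] cnj_z_square_abs[OF f(1)] mult_op2_abs(1)[OF bd g]
          cnj_z_square_abs[OF mult_op2_abs(2)[OF bd f(1)]]
        by (intro abs_L2T_eqI mult_op2_abs(2)[OF bd g] square_integrable_mult
            essentially_bounded_cnj_square mult_op2_abs(2)[OF bd f(1)]) (simp add: field_simps)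
    qed
  qed
qed

section \<open>Operators commuting with multiplication by the square\<close>

definition fourier :: "int \<Rightarrow> L2T" where
  "fourier k = abs_L2T (\<lambda>z. z powi k)"

lemma square_integrable_powi_1: "square_integrable (\<lambda>z. z powi k)"
  using square_integrable_powi[OF square_integrable_1, of k] by simp

text \<open>Even and odd exponents are exchanged, which is what later links the two symbols.\<close>

lemma conj_z2_fourier: "conj_z2 (fourier k) = fourier (1 - k)"
  unfolding fourier_def conj_z2_abs[OF square_integrable_powi_1]
  by (intro abs_L2T_eqI square_integrable_conj_z2 square_integrable_powi_1)
    (simp add: cnj_powi power_int_diff power_int_minus unit_nonzero field_simps
      del: complex_cnj_power_int)

lemma z_square_powi:
  assumes "square_integrable w"
  shows "mult_op z_square (abs_L2T (\<lambda>z. w z * z powi k)) = abs_L2T (\<lambda>z. w z * z powi (k + 2))"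
  unfolding z_square_abs[OF square_integrable_powi[OF assms]]
  by (intro abs_L2T_eqI square_integrable_square square_integrable_powi assms)
    (subst power_int_add, auto)

lemma z_square_fourier: "mult_op z_square (fourier k) = fourier (k + 2)"
  using z_square_powi[OF square_integrable_1] by (simp add: fourier_def)

text \<open>On the circle the conjugate of z^k is z^(-k), so the inner product is a Fourier
  coefficient of \<open>a z * cnj (b z)\<close>.\<close>

lemma cinner_powi:
  assumes "square_integrable a" "square_integrable b"
  shows "cinner (abs_L2T (\<lambda>z. a z * z powi j)) (abs_L2T (\<lambda>z. b z * z powi k)) =
    (\<integral>z. a z * cnj (b z) * z powi (j - k) \<partial>circle)"
  unfolding cinner_abs_L2T[OF square_integrable_powi[OF assms(1)] square_integrable_powi[OF assms(2)]]
proof (rule Bochner_Integration.integral_cong)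
  fix z assume "z \<in> space circle"
  then have z: "cmod z = 1" by (rule norm_circle)
  then have "z powi (j - k) = z powi j * cnj (z powi k)"
    unfolding cnj_powi[OF z] by (subst power_int_add [symmetric]) auto
  then show "a z * z powi j * cnj (b z * z powi k) = a z * cnj (b z) * z powi (j - k)"
    by simp
qed simp

lemma cinner_powi_fourier:
  assumes "square_integrable a"
  shows "cinner (abs_L2T (\<lambda>z. a z * z powi j)) (fourier k) = (\<integral>z. a z * z powi (j - k) \<partial>circle)"
  using cinner_powi[OF assms square_integrable_1] by (simp add: fourier_def)

text \<open>The integral stays unevaluated: it is compared with one from \<open>cinner_powi\<close>,
  and the difference is a coefficient of \<open>a z * cnj (b z) - 1\<close>.\<close>

lemma cinner_fourier: "cinner (fourier j) (fourier k) = (\<integral>z. z powi (j - k) \<partial>circle)"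
  using cinner_powi[OF square_integrable_1 square_integrable_1] by (simp add: fourier_def)

lemma square_integrable_imp_integrable:
  "square_integrable f \<Longrightarrow> integrable circle f"
  using integrable_inner[OF _ square_integrable_1, of f] by simp

text \<open>On this finite measure space L^2 lies in L^1, where the Fourier coefficients determine
  the function.\<close>

lemma fourier_complete:
  assumes "\<And>k. cinner F (fourier k) = 0"
  shows "F = 0"
proof (cases F rule: L2T_cases)
  case (1 f)
  have "(\<integral>z. f z * z powi k \<partial>circle) = 0" for k
    using cinner_powi_fourier[OF 1(1), of 0 "- k"] assms[of "- k"] 1 by simp
  then have "zero_coeffs f"
    using 1 by (simp add: zero_coeffs_def square_integrable_imp_integrable)
  then have "AE z in circle. f z = 0"
    by (rule zero_coeffs_AE_zero)
  then show ?thesis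
    using 1 by (simp add: zero_L2T_def abs_L2T_eq_iff square_integrable_0)
qed

text \<open>The image of z^k determines the images of all powers of the same parity, since
  commutation moves the exponent by 2 in either direction.\<close>

lemma commute_z_square_fourier:
  assumes comm: "\<And>F. A (mult_op z_square F) = mult_op z_square (A F)"
  obtains w where "square_integrable w"
    "\<And>n. A (fourier (k + 2 * n)) = abs_L2T (\<lambda>z. w z * z powi (k + 2 * n))"
proof -
  obtain g where g: "square_integrable g" "A (fourier k) = abs_L2T g"
    by (rule L2T_cases)
  \<comment> \<open>Dividing out z^k gives one symbol for all exponents of this parity.\<close>
  define w where "w z = g z * z powi (- k)" for z
  have w: "square_integrable w"
    unfolding w_def by (intro square_integrable_powi g)
  have A_k: "A (fourier k) = abs_L2T (\<lambda>z. w z * z powi k)"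
    unfolding g(2)
    by (intro abs_L2T_eqI square_integrable_powi w g) (simp add: w_def power_int_minus unit_nonzero)
  have "A (fourier (k + 2 * n)) = abs_L2T (\<lambda>z. w z * z powi (k + 2 * n))" for n
  proof (induction n rule: int_induct[where k=0])
    case base
    show ?case using A_k by simp
  next
    case (step1 i)
    have "A (fourier (k + 2 * i + 2)) = mult_op z_square (A (fourier (k + 2 * i)))"
      by (simp add: comm flip: z_square_fourier)
    then show ?case
      unfolding step1 z_square_powi[OF w] by (simp add: algebra_simps)
  next
    case (step2 i)
    \<comment> \<open>Downwards, both sides agree after multiplication by z^2, which is then
      cancelled.\<close>
    have "mult_op z_square (A (fourier (k + 2 * (i - 1)))) = A (fourier (k + 2 * i))"
      by (simp add: z_square_fourier flip: comm)
    also have "\<dots> = mult_op z_square (abs_L2T (\<lambda>z. w z * z powi (k + 2 * (i - 1))))"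
      unfolding step2 z_square_powi[OF w] by (simp add: algebra_simps)
    finally show ?case
      by (metis cnj_z_square_z_square)
  qed
  with w show ?thesis by (rule that)
qed


section \<open>Symbols of isometries\<close>

text \<open>Below, $u', v', f', g'$ stand for the values at $-z$.\<close>

lemma symbol_norm_square:
  fixes u v u' v' :: complex
  assumes "u * cnj u + u' * cnj u' = 2" "v * cnj v + v' * cnj v' = 2"
    and "u * cnj v = u' * cnj v'" "u + u' = v + v'"
  shows "(cmod u)\<^sup>2 + (cmod v)\<^sup>2 = 2"
proof -
  have "cnj u * v = cnj u' * v'" "cnj u + cnj u' = cnj v + cnj v'"
    using assms(3,4) by (metis complex_cnj_cnj complex_cnj_mult, metis complex_cnj_add)
  \<comment> \<open>From u - v = -(u' - v') and the equal cross terms, |u|^2 + |v|^2 = |u'|^2 +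
    |v'|^2; the two sides add up to 4.\<close>
  then have "u * cnj u + v * cnj v = 2"
    using assms by algebra
  then have "complex_of_real ((cmod u)\<^sup>2 + (cmod v)\<^sup>2) = 2"
    by (simp add: complex_norm_square del: of_real_power)
  then show ?thesis
    by (metis of_real_eq_iff of_real_numeral)
qed

text \<open>With p and q the even and odd parts of f, the operator takes the values u p + v q at z
  and u' p - v' q at -z.\<close>

lemma symbol_isometry_pointwise:
  fixes u v u' v' f f' g g' :: complex
  assumes "u * cnj u + u' * cnj u' = 2" "v * cnj v + v' * cnj v' = 2" "u * cnj v = u' * cnj v'"
  shows "(u * ((f + f') / 2) + v * ((f - f') / 2)) * cnj (u * ((g + g') / 2) + v * ((g - g') / 2)) +
    (u' * ((f' + f) / 2) + v' * ((f' - f) / 2)) * cnj (u' * ((g' + g) / 2) + v' * ((g' - g) / 2)) =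
    f * cnj g + f' * cnj g'"
proof -
  define p q r s where "p = (f + f') / 2" "q = (f - f') / 2" "r = cnj ((g + g') / 2)" "s = cnj ((g - g') / 2)"
  have "f = p + q" "f' = p - q" "cnj g = r + s" "cnj g' = r - s"
    by (auto simp: p_q_r_s_def field_simps)
  moreover have "cnj u * v = cnj u' * v'"
    using assms(3) by (metis complex_cnj_cnj complex_cnj_mult)
  moreover have "(u * p + v * q) * (cnj u * r + cnj v * s) + (u' * p - v' * q) * (cnj u' * r - cnj v' * s) =
    (p + q) * (r + s) + (p - q) * (r - s)"
    if "cnj u * v = cnj u' * v'"
  proof -
    \<comment> \<open>Grouped so that the first two brackets equal 2 and the cross terms
      vanish.\<close>
    have "(u * p + v * q) * (cnj u * r + cnj v * s) + (u' * p - v' * q) * (cnj u' * r - cnj v' * s) =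
      p * r * (u * cnj u + u' * cnj u') + q * s * (v * cnj v + v' * cnj v') +
      p * s * (u * cnj v - u' * cnj v') + q * r * (cnj u * v - cnj u' * v')"
      by (simp add: algebra_simps)
    also have "\<dots> = p * r * 2 + q * s * 2"
      using assms that by simp
    finally show ?thesis
      by (simp add: algebra_simps)
  qed
  moreover have "u * ((f + f') / 2) + v * ((f - f') / 2) = u * p + v * q"
    "cnj (u * ((g + g') / 2) + v * ((g - g') / 2)) = cnj u * r + cnj v * s"
    "u' * ((f' + f) / 2) + v' * ((f' - f) / 2) = u' * p - v' * q"
    "cnj (u' * ((g' + g) / 2) + v' * ((g' - g) / 2)) = cnj u' * r - cnj v' * s"
    by (simp_all add: p_q_r_s_def field_simps)
  ultimately show ?thesis
    by simp
qed

text \<open>The integrands of the two inner products need not agree at a point, but their difference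
  K satisfies K(z) + K(-z) = 0, and reflection invariance makes its integral 0.\<close>

lemma symbol_isometry:
  assumes eb: "essentially_bounded u" "essentially_bounded v"
    and u: "AE z in circle. u z * cnj (u z) + u (- z) * cnj (u (- z)) = 2"
    and v: "AE z in circle. v z * cnj (v z) + v (- z) * cnj (v (- z)) = 2"
    and uv: "AE z in circle. u z * cnj (v z) = u (- z) * cnj (v (- z))"
  shows "cinner (mult_op2 (abs_LinfT u) (abs_LinfT v) F) (mult_op2 (abs_LinfT u) (abs_LinfT v) G) = cinner F G"
proof (cases F rule: L2T_cases)
  case f: (1 f)
  show ?thesis
  proof (cases G rule: L2T_cases)
    case g: (1 g)
    let ?M = "\<lambda>f z. u z * ((f z + f (- z)) / 2) + v z * ((f z - f (- z)) / 2)"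
    define K where "K z = ?M f z * cnj (?M g z) - f z * cnj (g z)" for z
    have M: "square_integrable (?M f)" "square_integrable (?M g)"
      using mult_op2_abs(2)[OF eb] f g by auto
    have K: "integrable circle K"
      unfolding K_def by (intro Bochner_Integration.integrable_diff integrable_inner M f g)
    have "AE z in circle. K z + K (- z) = 0"
      using u v uv
    proof eventually_elim
      case (elim z)
      then show ?case
        using symbol_isometry_pointwise[OF elim, of "f z" "f (- z)" "g z" "g (- z)"]
        unfolding K_def minus_minus add_diff_add [symmetric] by (simp only: right_minus_eq)
    qed
    then have "(\<integral>z. K z + K (- z) \<partial>circle) = 0"
      by (rule integral_eq_zero_AE)
    then have "(\<integral>z. K z \<partial>circle) = 0"
      using K integrable_circle_reflect[OF K] by (simp add: integral_circle_reflect)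
    then have "(\<integral>z. ?M f z * cnj (?M g z) \<partial>circle) = (\<integral>z. f z * cnj (g z) \<partial>circle)"
      unfolding K_def
      by (subst (asm) Bochner_Integration.integral_diff) (simp_all only: integrable_inner M f g right_minus_eq)
    then show ?thesis
      unfolding f(2) g(2) mult_op2_abs(1)[OF eb f(1)] mult_op2_abs(1)[OF eb g(1)]
        cinner_abs_L2T[OF M] cinner_abs_L2T[OF f(1) g(1)] .
  qed
qed

text \<open>Each z^k is purely even or purely odd, so only one symbol acts on it.\<close>

lemma mult_op2_fourier:
  assumes "essentially_bounded u" "essentially_bounded v"
  shows "mult_op2 (abs_LinfT u) (abs_LinfT v) (fourier k) =
    abs_L2T (\<lambda>z. (if even k then u z else v z) * z powi k)"
  unfolding fourier_def mult_op2_abs(1)[OF assms square_integrable_powi_1]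
proof (rule abs_L2T_eqI)
  have "square_integrable (\<lambda>z. \<phi> z * z powi k)" if "essentially_bounded \<phi>" for \<phi>
    using that square_integrable_powi_1 by (rule square_integrable_mult)
  then show "square_integrable (\<lambda>z. (if even k then u z else v z) * z powi k)"
    using assms by (cases "even k") simp_all
qed (use mult_op2_abs(2)[OF assms square_integrable_powi_1] in simp_all)

lemma cinner_diff_left: "cinner (F - G) H = cinner F H - cinner G (H :: 'a :: complex_inner)"
  using cinner_add_left[of "F - G" G H] by simp

theorem theorem4p1:
  fixes C :: "L2T \<Rightarrow> L2T"
  assumes "conjugation C"
  shows "(C \<circ> mult_op z_square = mult_op cnj_z_square \<circ> C \<longrightarrow>
      (\<exists>\<phi>\<^sub>1 \<phi>\<^sub>2 :: LinfT. C = mult_op2 \<phi>\<^sub>1 \<phi>\<^sub>2 \<circ> conj_z2 \<and>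
        norm_square_sum_eq \<phi>\<^sub>1 \<phi>\<^sub>2 2 \<and> even_Linf \<phi>\<^sub>1 = even_Linf \<phi>\<^sub>2)) \<and>
    (\<forall>\<phi>\<^sub>1 \<phi>\<^sub>2 :: LinfT. C = mult_op2 \<phi>\<^sub>1 \<phi>\<^sub>2 \<circ> conj_z2 \<longrightarrow>
      C \<circ> mult_op z_square = mult_op cnj_z_square \<circ> C)"
proof (intro conjI impI allI)
  fix \<phi>\<^sub>1 \<phi>\<^sub>2 :: LinfT
  assume "C = mult_op2 \<phi>\<^sub>1 \<phi>\<^sub>2 \<circ> conj_z2"
  then show "C \<circ> mult_op z_square = mult_op cnj_z_square \<circ> C"
    by (simp add: fun_eq_iff conj_z2_z_square mult_op2_cnj_z_square)
next

  \<comment> \<open>The isometry A and its two symbols\<close>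
  assume "C \<circ> mult_op z_square = mult_op cnj_z_square \<circ> C"
  then have comm: "C (mult_op z_square F) = mult_op cnj_z_square (C F)" for F
    by (simp add: fun_eq_iff)
  have CC: "C (C F) = F" for F
    using assms by (simp add: conjugation_def fun_eq_iff)
  have C_inner: "cinner (C F) (C G) = cinner G F" for F G
    using assms by (simp add: conjugation_def)
  define A where "A F = C (conj_z2 F)" for F
  have A_inner: "cinner (A F) (A G) = cinner F G" for F G
    by (simp add: A_def C_inner cinner_conj_z2)
  \<comment> \<open>This is \<open>comm\<close> at \<open>mult_op cnj_z_square F\<close>, with both
    sides multiplied by z^2.\<close>
  have "C (mult_op cnj_z_square F) = mult_op z_square (C F)" for F
    by (metis CC comm z_square_cnj_z_square)
  then have A_comm: "A (mult_op z_square F) = mult_op z_square (A F)" for F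
    by (simp add: A_def conj_z2_z_square)
  obtain u where u: "square_integrable u"
      "\<And>n. A (fourier (2 * n)) = abs_L2T (\<lambda>z. u z * z powi (2 * n))"
    using commute_z_square_fourier[of A 0, OF A_comm] by auto
  obtain v where v: "square_integrable v"
      "\<And>n. A (fourier (1 + 2 * n)) = abs_L2T (\<lambda>z. v z * z powi (1 + 2 * n))"
    using commute_z_square_fourier[of A 1, OF A_comm] by auto
  \<comment> \<open>The powers \<open>z powi 0\<close> and \<open>z powi 1\<close> are kept so that
    \<open>cinner_powi\<close> matches.\<close>
  note A0 = u(2)[of 0, unfolded mult_zero_right] and A1 = v(2)[of 0, unfolded mult_zero_right add_0_right]

  \<comment> \<open>Pointwise relations between the symbols\<close>
  have "AE z in circle. (u z * cnj (u z) - 1) + (u (- z) * cnj (u (- z)) - 1) = 0"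
  proof (rule even_coeffs_zero_AE)
    fix n :: int
    have "(\<integral>z. u z * cnj (u z) * z powi (2 * n) \<partial>circle) = (\<integral>z. z powi (2 * n) \<partial>circle)"
      using A_inner[of "fourier (2 * n)" "fourier 0"] u(1) unfolding u(2) A0
      by (simp only: cinner_powi cinner_fourier diff_0_right)
    then show "(\<integral>z. (u z * cnj (u z) - 1) * z powi (2 * n) \<partial>circle) = 0"
      using u(1) by (simp add: left_diff_distrib integrable_circle_powi integrable_inner
          square_integrable_imp_integrable square_integrable_powi_1)
  qed (simp add: integrable_inner u)
  then have uu: "AE z in circle. u z * cnj (u z) + u (- z) * cnj (u (- z)) = 2"
    by eventually_elim (simp add: algebra_simps)

  have "AE z in circle. (v z * cnj (v z) - 1) + (v (- z) * cnj (v (- z)) - 1) = 0"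
  proof (rule even_coeffs_zero_AE)
    fix n :: int
    have "(\<integral>z. v z * cnj (v z) * z powi (2 * n) \<partial>circle) = (\<integral>z. z powi (2 * n) \<partial>circle)"
      using A_inner[of "fourier (1 + 2 * n)" "fourier 1"] v(1) unfolding v(2) A1
      by (simp only: cinner_powi cinner_fourier add_diff_cancel_left')
    then show "(\<integral>z. (v z * cnj (v z) - 1) * z powi (2 * n) \<partial>circle) = 0"
      using v(1) by (simp add: left_diff_distrib integrable_circle_powi integrable_inner
          square_integrable_imp_integrable square_integrable_powi_1)
  qed (simp add: integrable_inner v)
  then have vv: "AE z in circle. v z * cnj (v z) + v (- z) * cnj (v (- z)) = 2"
    by eventually_elim (simp add: algebra_simps)

  \<comment> \<open>Pairing z^(2n) with z gives odd exponents. The factor z^(-1) makes them even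
    and, being odd itself, turns the sum over z and -z into a difference.\<close>
  have "AE z in circle. (u z * cnj (v z) - 1) * z powi (- 1) + (u (- z) * cnj (v (- z)) - 1) * (- z) powi (- 1) = 0"
  proof (rule even_coeffs_zero_AE)
    have uvi: "integrable circle (\<lambda>z. u z * cnj (v z))"
      by (intro integrable_inner u v)
    then show "integrable circle (\<lambda>z. (u z * cnj (v z) - 1) * z powi (- 1))"
      by (intro integrable_circle_powi) simp
    fix n :: int
    have "(\<integral>z. u z * cnj (v z) * z powi (2 * n - 1) \<partial>circle) = (\<integral>z. z powi (2 * n - 1) \<partial>circle)"
      using A_inner[of "fourier (2 * n)" "fourier 1"] u(1) v(1) unfolding u(2) A1
      by (simp only: cinner_powi cinner_fourier)
    then have "(\<integral>z. (u z * cnj (v z) - 1) * z powi (2 * n - 1) \<partial>circle) = 0"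
      using uvi by (simp add: left_diff_distrib integrable_circle_powi
          square_integrable_imp_integrable square_integrable_powi_1)
    moreover have "(\<integral>z. (u z * cnj (v z) - 1) * z powi (- 1) * z powi (2 * n) \<partial>circle) =
        (\<integral>z. (u z * cnj (v z) - 1) * z powi (2 * n - 1) \<partial>circle)"
      by (rule Bochner_Integration.integral_cong)
        (auto simp: power_int_diff power_int_minus field_simps dest!: norm_circle unit_nonzero)
    ultimately show "(\<integral>z. (u z * cnj (v z) - 1) * z powi (- 1) * z powi (2 * n) \<partial>circle) = 0"
      by simp
  qed
  then have uv: "AE z in circle. u z * cnj (v z) = u (- z) * cnj (v (- z))"
    using AE_space
  proof eventually_elim
    case (elim z)
    then have "z \<noteq> 0"
      using norm_circle unit_nonzero by blast
    then show ?case
      using elim(1) by (simp add: power_int_minus field_simps)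
  qed

  have "AE z in circle. (u z - v z) + (u (- z) - v (- z)) = 0"
  proof (rule even_coeffs_zero_AE)
    show "integrable circle (\<lambda>z. u z - v z)"
      by (intro Bochner_Integration.integrable_diff square_integrable_imp_integrable u v)
    fix n :: int
    have C_sym: "cinner (C F) G = cinner (C G) F" for F G
      using C_inner[of F "C G"] by (simp add: CC)
    \<comment> \<open>By \<open>conj_z2_fourier\<close>, A maps z^(1+2n) to C z^(-2n) and 1 to C z,
      so this is an instance of the symmetry of C.\<close>
    have "cinner (A (fourier (1 + 2 * n))) (fourier 1) = cinner (A (fourier 0)) (fourier (- (2 * n)))"
      using C_sym[of "fourier (- (2 * n))" "fourier 1"] by (simp add: A_def conj_z2_fourier)
    then have "(\<integral>z. v z * z powi (2 * n) \<partial>circle) = (\<integral>z. u z * z powi (2 * n) \<partial>circle)"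
      unfolding v(2) A0 by (simp add: cinner_powi_fourier u v del: power_int_0_right)
    then show "(\<integral>z. (u z - v z) * z powi (2 * n) \<partial>circle) = 0"
      using u v by (simp add: left_diff_distrib integrable_circle_powi square_integrable_imp_integrable)
  qed
  then have even: "AE z in circle. u z + u (- z) = v z + v (- z)"
    by eventually_elim (simp add: algebra_simps)

  have norm2: "AE z in circle. (cmod (u z))\<^sup>2 + (cmod (v z))\<^sup>2 = 2"
    using uu vv uv even by eventually_elim (rule symbol_norm_square)
  \<comment> \<open>Until here the symbols are only known to be square integrable; a crude bound
    puts them in L^\<infinity>.\<close>
  have "AE z in circle. cmod (u z) \<le> 2 \<and> cmod (v z) \<le> 2"
    using norm2
  proof eventually_elim
    case (elim z)
    then have "(cmod (u z))\<^sup>2 \<le> 4" "(cmod (v z))\<^sup>2 \<le> 4"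
      using zero_le_power2[of "cmod (u z)"] zero_le_power2[of "cmod (v z)"] by - (linarith+)
    then show ?case
      using power2_le_imp_le[of "cmod (u z)" 2] power2_le_imp_le[of "cmod (v z)" 2] by simp
  qed
  then have eb: "essentially_bounded u" "essentially_bounded v"
    using u(1) v(1) by (auto simp: essentially_bounded_def square_integrable_def)

  \<comment> \<open>Identification of A with the operator given by its symbols\<close>
  let ?M = "mult_op2 (abs_LinfT u) (abs_LinfT v)"
  have M_fourier: "?M (fourier k) = A (fourier k)" for k
  proof (cases "even k")
    case True
    then obtain n where "k = 2 * n" by (rule evenE)
    then show ?thesis using u(2) by (simp add: mult_op2_fourier[OF eb])
  next
    case False
    then obtain n where "k = 2 * n + 1" by (rule oddE)
    then show ?thesis using v(2)[of n] by (simp add: mult_op2_fourier[OF eb] add.commute)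
  qed
  have "A F = ?M F" for F
  proof -
    \<comment> \<open>The preimage under A of the defect: C and \<open>conj_z2\<close> are
      involutions.\<close>
    define G where "G = conj_z2 (C (A F - ?M F))"
    have AG: "A G = A F - ?M F"
      by (simp add: A_def G_def conj_z2_conj_z2 CC)
    have "cinner G (fourier k) = 0" for k
    proof -
      have "cinner G (fourier k) = cinner (A G) (A (fourier k))"
        by (simp add: A_inner)
      \<comment> \<open>Both operators are isometric and agree on z^k, so both terms equal the inner
        product of F with z^k.\<close>
      also have "\<dots> = cinner (A F) (A (fourier k)) - cinner (?M F) (?M (fourier k))"
        by (simp add: AG cinner_diff_left M_fourier)
      also have "\<dots> = 0"
        by (simp add: A_inner symbol_isometry[OF eb uu vv uv])
      finally show ?thesis .
    qed
    then have "G = 0"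
      by (rule fourier_complete)
    then have "cinner (A G) (A G) = 0"
      by (simp add: A_inner cinner_eq_zero_iff)
    then show ?thesis
      by (simp add: AG cinner_eq_zero_iff)
  qed
  then have "C F = ?M (conj_z2 F)" for F
    by (metis A_def conj_z2_conj_z2)
  then have "C = ?M \<circ> conj_z2"
    by (simp add: fun_eq_iff)
  moreover have "norm_square_sum_eq (abs_LinfT u) (abs_LinfT v) 2"
    using eb norm2 by (simp add: norm_square_sum_eq.abs_eq Linf_rel_def)
  moreover have "even_Linf (abs_LinfT u) = even_Linf (abs_LinfT v)"
  proof -
    have "AE z in circle. (u z + u (- z)) / 2 = (v z + v (- z)) / 2"
      using even by eventually_elim simp
    then have "Linf_rel (\<lambda>z. (u z + u (- z)) / 2) (\<lambda>z. (v z + v (- z)) / 2)"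
      using eb by (simp add: Linf_rel_def essentially_bounded_even)
    then show ?thesis
      using eb Quotient3_rel_abs[OF Quotient3_LinfT] by (simp add: even_Linf.abs_eq Linf_rel_def)
  qed
  ultimately show "\<exists>\<phi>\<^sub>1 \<phi>\<^sub>2 :: LinfT. C = mult_op2 \<phi>\<^sub>1 \<phi>\<^sub>2 \<circ> conj_z2 \<and>
      norm_square_sum_eq \<phi>\<^sub>1 \<phi>\<^sub>2 2 \<and> even_Linf \<phi>\<^sub>1 = even_Linf \<phi>\<^sub>2"
    by blast
qed

end
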